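(* Let $\mathcal{X}$ be an infinite-dimensional real Banach space and let $S$ be a partial complex structure on $\mathcal{X}$ which is a closed operator. Then $$\mathcal{A}_S=\{T\in\mathcal{B}(\mathcal{X}): TS\subset ST\}$$ is a Lomonosov algebra of complex type on $\mathcal{X}$.
   Context: $\mathcal{B}(\mathcal{X})$ is the algebra of all bounded linear operators on $\mathcal{X}$; SOT is the strong operator topology. A partial complex structure on $\mathcal{X}$ is a linear operator $S$ defined on a dense linear subspace $\mathcal{D}(S)\subset\mathcal{X}$, taking values in $\mathcal{X}$, such that $S^{-1}=-S$ (so $S\mathcal{D}(S)=\mathcal{D}(S)$ and $S^2x=-x$ for $x\in\mathcal{D}(S)$). $TS\subset ST$ means that for all $x\in\mathcal{D}(S)$ one has $Tx\in\mathcal{D}(S)$ and $TSx=STx$. A subalgebra of $\mathcal{B}(\mathcal{X})$ is transitive if it has no non-trivial closed invariant subspaces. A Lomonosov algebra is an SOT-closed transitive subalgebra of $\mathcal{B}(\mathcal{X})$ containing a non-zero compact operator; an $L$-algebra is a transitive subalgebra containing a non-zero finite rank operator. (Lomonosov algebras are exactly the SOT-closed $L$-algebras.) For an $L$-algebra $\mathcal{A}$, $\mathcal{A}^F$ is the set of all finite rank operators in $\mathcal{A}$, $\mathcal{X}^F=\mathrm{lin}\{Tx: T\in\mathcal{A}^F, x\in\mathcal{X}\}$, and $\mathbb{D}$ is the algebra of all linear operators $\mathcal{X}^F\to\mathcal{X}^F$ (not assumed bounded) commuting with the restrictions to $\mathcal{X}^F$ of all operators in $\mathcal{A}^F$; $\mathbb{D}$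 is always isomorphic to $\mathbb{R}$, $\mathbb{C}$ or the quaternions $\mathbb{H}$, and $\mathcal{A}$ is said to be of real, complex or quaternion type, respectively. *)

theory Defs
  imports "HOL-Analysis.Analysis"
begin

definition subalgebra :: "('a::real_normed_vector \<Rightarrow>\<^sub>L 'a) set \<Rightarrow> bool" where
  "subalgebra A \<longleftrightarrow> subspace A \<and> (\<forall>T\<in>A. \<forall>U\<in>A. T o\<^sub>L U \<in> A)"

definition transitive :: "('a::real_normed_vector \<Rightarrow>\<^sub>L 'a) set \<Rightarrow> bool" where
  "transitive A \<longleftrightarrow>
     (\<forall>M. subspace M \<and> closed M \<and> (\<forall>T\<in>A. blinfun_apply T ` M \<subseteq> M) \<longrightarrow> M = {0} \<or> M = UNIV)"

definition compact_operator :: "('a::real_normed_vector \<Rightarrow>\<^sub>L 'b::real_normed_vector) \<Rightarrow> bool" where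
  "compact_operator T \<longleftrightarrow> (\<forall>B. bounded B \<longrightarrow> compact (closure (blinfun_apply T ` B)))"

definition finite_rank :: "('a::real_normed_vector \<Rightarrow>\<^sub>L 'b::real_normed_vector) \<Rightarrow> bool" where
  "finite_rank T \<longleftrightarrow> (\<exists>B. finite B \<and> range (blinfun_apply T) \<subseteq> span B)"

definition Lomonosov_algebra :: "('a::banach \<Rightarrow>\<^sub>L 'a) set \<Rightarrow> bool" where
  "Lomonosov_algebra A \<longleftrightarrow> subalgebra A \<and> transitive A \<and> closedin strong_operator_topology A \<and>
     (\<exists>T\<in>A. T \<noteq> 0 \<and> compact_operator T)"

definition L_algebra :: "('a::banach \<Rightarrow>\<^sub>L 'a) set \<Rightarrow> bool" where
  "L_algebra A \<longleftrightarrow> subalgebra A \<and> transitive A \<and> (\<exists>T\<in>A. T \<noteq> 0 \<and> finite_rank T)"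

definition finite_rank_part :: "('a::real_normed_vector \<Rightarrow>\<^sub>L 'a) set \<Rightarrow> ('a \<Rightarrow>\<^sub>L 'a) set" where
  "finite_rank_part A = {T \<in> A. finite_rank T}"

definition finite_rank_space :: "('a::real_normed_vector \<Rightarrow>\<^sub>L 'a) set \<Rightarrow> 'a set" where
  "finite_rank_space A = span {blinfun_apply T x |T x. T \<in> finite_rank_part A}"

text \<open>A linear operator with domain the subspace \<open>D\<close> is given by a total function of which only
  the values on \<open>D\<close> matter.\<close>

definition linear_operator_on :: "'a::real_vector set \<Rightarrow> ('a \<Rightarrow> 'b::real_vector) \<Rightarrow> bool" where
  "linear_operator_on D S \<longleftrightarrow> subspace D \<and> (\<forall>x\<in>D. \<forall>y\<in>D. S (x + y) = S x + S y) \<and>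
     (\<forall>c. \<forall>x\<in>D. S (c *\<^sub>R x) = c *\<^sub>R S x)"

text \<open>The algebra of all linear, possibly unbounded, operators on \<open>finite_rank_space A\<close> that commute
  with the finite rank operators of \<open>A\<close>. Its elements are extensional functions, so that equality
  of functions is equality of operators on \<open>finite_rank_space A\<close>.\<close>

definition finite_rank_commutant :: "('a::real_normed_vector \<Rightarrow>\<^sub>L 'a) set \<Rightarrow> ('a \<Rightarrow> 'a) set" where
  "finite_rank_commutant A =
     {R \<in> finite_rank_space A \<rightarrow>\<^sub>E finite_rank_space A. linear_operator_on (finite_rank_space A) R \<and>
        (\<forall>T\<in>finite_rank_part A. \<forall>x\<in>finite_rank_space A.
           R (blinfun_apply T x) = blinfun_apply T (R x))}"

text \<open>An isomorphism of real algebras from the complex numbers onto \<open>finite_rank_commutant A\<close>, the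
  latter with pointwise linear operations and with composition as product.\<close>

definition complex_type :: "('a::banach \<Rightarrow>\<^sub>L 'a) set \<Rightarrow> bool" where
  "complex_type A \<longleftrightarrow> L_algebra A \<and>
     (\<exists>\<phi>. bij_betw \<phi> (UNIV :: complex set) (finite_rank_commutant A) \<and>
        (\<forall>x\<in>finite_rank_space A. \<forall>z w c.
           \<phi> (z + w) x = \<phi> z x + \<phi> w x \<and>
           \<phi> (c *\<^sub>R z) x = c *\<^sub>R \<phi> z x \<and>
           \<phi> (z * w) x = \<phi> z (\<phi> w x)))"

text \<open>The last three conjuncts say \<open>S\<^sup>-\<^sup>1 = - S\<close> as partial operators: the domain \<open>S ` D\<close> of the
  inverse is the domain \<open>D\<close> of \<open>- S\<close>, and the values agree.\<close>

definition partial_complex_structure :: "'a::real_normed_vector set \<Rightarrow> ('a \<Rightarrow> 'a) \<Rightarrow> bool" where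
  "partial_complex_structure D S \<longleftrightarrow> linear_operator_on D S \<and> closure D = UNIV \<and>
     inj_on S D \<and> S ` D = D \<and> (\<forall>x\<in>D. the_inv_into D S x = - S x)"

definition closed_operator ::
    "'a::real_normed_vector set \<Rightarrow> ('a \<Rightarrow> 'b::real_normed_vector) \<Rightarrow> bool" where
  "closed_operator D S \<longleftrightarrow> closed {(x, S x) |x. x \<in> D}"

definition commuting_algebra ::
    "'a::real_normed_vector set \<Rightarrow> ('a \<Rightarrow> 'a) \<Rightarrow> ('a \<Rightarrow>\<^sub>L 'a) set" where
  "commuting_algebra D S =
     {T. \<forall>x\<in>D. blinfun_apply T x \<in> D \<and> blinfun_apply T (S x) = S (blinfun_apply T x)}"

lemma partial_complex_structure_iff:
  "partial_complex_structure D S \<longleftrightarrow> linear_operator_on D S \<and> closure D = UNIV \<and>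
     S ` D = D \<and> (\<forall>x\<in>D. S (S x) = - x)"
proof -
  have "inj_on S D \<and> S ` D = D \<and> (\<forall>x\<in>D. the_inv_into D S x = - S x) \<longleftrightarrow>
      S ` D = D \<and> (\<forall>x\<in>D. S (S x) = - x)" (is "?L \<longleftrightarrow> ?R") if lin: "linear_operator_on D S"
  proof
    have sub: "subspace D" and scale: "\<And>c x. x \<in> D \<Longrightarrow> S (c *\<^sub>R x) = c *\<^sub>R S x"
      using lin unfolding linear_operator_on_def by blast+
    have neg: "- x \<in> D" "S (- x) = - S x" if "x \<in> D" for x
      using subspace_neg[OF sub that] scale[OF that, of "-1"] by simp_all
    show ?R if L: ?L
    proof (intro conjI ballI)
      show "S ` D = D" using L by (elim conjE)
      fix x assume x: "x \<in> D"
      have "S x \<in> D" using L x by blast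
      moreover have "S (the_inv_into D S x) = x"
        by (rule f_the_inv_into_f) (use L x in simp_all)
      moreover have "the_inv_into D S x = - S x" using L x by simp
      ultimately have "- S (S x) = x" using neg(2)[of "S x"] by argo
      then show "S (S x) = - x" using minus_minus[of "S (S x)"] by argo
    qed
    show ?L if R: ?R
    proof (intro conjI ballI)
      show "S ` D = D" using R by (elim conjE)
      have invol: "S (S x) = - x" if "x \<in> D" for x using R that by blast
      show inj: "inj_on S D"
      proof (rule inj_onI)
        fix x y assume x: "x \<in> D" and y: "y \<in> D" and eq: "S x = S y"
        have "- x = - y" using invol[OF x] invol[OF y] unfolding eq by (rule trans[OF sym])
        then show "x = y" by simp
      qed
      fix x assume x: "x \<in> D"
      have "S x \<in> D" using R x by blast
      then have "- S x \<in> D" "S (- S x) = x" using neg[of "S x"] invol[OF x] by auto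
      then show "the_inv_into D S x = - S x" using the_inv_into_f_f[OF inj, of "- S x"] by simp
    qed
  qed
  then show ?thesis
    unfolding partial_complex_structure_def by (intro conj_cong[OF refl])
qed

end

theory Submission
  imports Defs
begin

text \<open>
  The graph \<open>G\<close> of \<open>S\<close> is a closed subspace of \<open>\<X> \<times> \<X>\<close>, and it is the closedness of \<open>G\<close> that
  supplies operators in \<open>commuting_algebra D S\<close>. For \<open>x \<noteq> 0\<close> the pair \<open>(0, x)\<close> is not in \<open>G\<close>, so by
  Hahn--Banach some bounded functional on \<open>\<X> \<times> \<X>\<close> vanishes on \<open>G\<close> but not at \<open>(0, x)\<close>. Its two
  components \<open>g, f\<close> satisfy \<open>f (S y) = - g y\<close> and \<open>g (S y) = f y\<close> on \<open>D\<close>; that is, \<open>f + i g\<close> is a bounded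
  functional which is complex linear on \<open>D\<close>, where \<open>i\<close> acts as \<open>S\<close>. After division by the complex
  number \<open>f x + i g x\<close> it takes the value \<open>1\<close> at \<open>x\<close>. For every \<open>v \<in> D\<close> the
  operator \<open>T\<^sub>v y = f y v + g y S v\<close>, which is \<open>y \<mapsto> (f + i g)(y) v\<close> in complex notation, commutes
  with \<open>S\<close>, has finite rank and sends \<open>x\<close> to \<open>v\<close>.

  All claims follow from these operators. A closed invariant subspace that contains some \<open>x \<noteq> 0\<close>
  contains the dense set \<open>D\<close>, which gives transitivity. The algebra is closed in the strong topology
  because membership says that \<open>(T x, T (S x)) \<in> G\<close> for every \<open>x \<in> D\<close>. An operator \<open>R\<close> that commutes
  with all \<open>T\<^sub>v\<close> built from one \<open>x \<in> D\<close> satisfies \<open>R v = R (T\<^sub>v x) = T\<^sub>v (R x) = (a + b S) v\<close>, where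
  \<open>a = f (R x)\<close> and \<open>b = g (R x)\<close> do not depend on \<open>v\<close>.

  For the commutant to consist of all \<open>a + b S\<close>, the space on which it acts has to be exactly \<open>D\<close>. It
  contains \<open>D\<close> since \<open>T\<^sub>v x = v\<close>. Conversely, if \<open>T\<close> in the algebra has finite rank, then \<open>T ` D\<close> is
  finite-dimensional, hence closed, so \<open>T\<close> maps \<open>\<X> = closure D\<close> into \<open>T ` D \<subseteq> D\<close>.
\<close>

section \<open>The Hahn--Banach theorem\<close>

definition sublinear :: "('a::real_vector \<Rightarrow> real) \<Rightarrow> bool" where
  "sublinear p \<longleftrightarrow> (\<forall>x y. p (x + y) \<le> p x + p y) \<and> (\<forall>c x. c \<ge> 0 \<longrightarrow> p (c *\<^sub>R x) = c * p x)"

lemma sublinearI: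
  assumes add: "\<And>x y. p (x + y) \<le> p x + p y"
    and zero: "p 0 = 0"
    and scale: "\<And>c x. c > 0 \<Longrightarrow> p (c *\<^sub>R x) \<le> c * p x"
  shows "sublinear p"
proof -
  have "p (c *\<^sub>R x) = c * p x" if "c \<ge> 0" for c x
  proof (cases "c = 0")
    case False
    then have c: "c > 0" using that by simp
    have "p x \<le> inverse c * p (c *\<^sub>R x)"
      using scale[of "inverse c" "c *\<^sub>R x"] c by simp
    then have "c * p x \<le> p (c *\<^sub>R x)"
      using c by (simp add: field_simps)
    then show ?thesis using scale[OF c, of x] by simp
  qed (simp add: zero)
  then show ?thesis using add by (simp add: sublinear_def)
qed

lemma sublinear_add: "sublinear p \<Longrightarrow> p (x + y) \<le> p x + p y"
  by (simp add: sublinear_def)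

lemma sublinear_scale: "sublinear p \<Longrightarrow> c \<ge> 0 \<Longrightarrow> p (c *\<^sub>R x) = c * p x"
  by (simp add: sublinear_def)

lemma sublinear_0: "sublinear p \<Longrightarrow> p 0 = 0"
  using sublinear_scale[of p 0 0] by simp

lemma sublinear_neg: "sublinear p \<Longrightarrow> - p (- x) \<le> p x"
  using sublinear_add[of p x "- x"] sublinear_0[of p] by simp

text \<open>The device behind both steps of the Hahn--Banach theorem: the largest sublinear function below
  \<open>p\<close> whose value at \<open>- y\<close> is at most \<open>- p y\<close>. Any such \<open>r\<close> satisfies
  \<open>r x \<le> r (x + t y) + t r (- y) \<le> p (x + t y) - t p y\<close> for \<open>t \<ge> 0\<close>, and the infimum of these bounds
  turns out to be sublinear itself.\<close>

lemma sublinear_lower_at: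
  assumes p: "sublinear p"
  obtains r where "sublinear r" "\<And>x. r x \<le> p x" "r (- y) \<le> - p y"
proof -
  define k where "k x t = p (x + t *\<^sub>R y) - t * p y" for x t
  define r where "r x = (INF t\<in>{0..}. k x t)" for x
  have lower: "- p (- x) \<le> k x t" if "t \<ge> 0" for x t
    using sublinear_add[OF p, of "x + t *\<^sub>R y" "- x"] sublinear_scale[OF p that, of y]
    by (simp add: k_def)
  have bdd: "bdd_below (k x ` {0..})" for x
    using lower by (intro bdd_belowI2[of _ "- p (- x)"]) auto
  have le: "r x \<le> k x t" if "t \<ge> 0" for x t
    unfolding r_def by (rule cINF_lower[OF bdd]) (use that in simp)
  have ge: "a \<le> r x" if "\<And>t. t \<ge> 0 \<Longrightarrow> a \<le> k x t" for a x
    unfolding r_def by (rule cINF_greatest) (use that in auto)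
  have "sublinear r"
  proof (rule sublinearI)
    fix x z
    have "r (x + z) - k x s \<le> k z t" if "s \<ge> 0" "t \<ge> 0" for s t
    proof -
      have "r (x + z) \<le> k (x + z) (s + t)" using le that by simp
      also have "\<dots> \<le> k x s + k z t"
        using sublinear_add[OF p, of "x + s *\<^sub>R y" "z + t *\<^sub>R y"]
        by (simp add: k_def algebra_simps)
      finally show ?thesis by simp
    qed
    then have "r (x + z) - k x s \<le> r z" if "s \<ge> 0" for s
      using that by (intro ge) auto
    then have "r (x + z) - r z \<le> r x"
      by (intro ge) (simp add: algebra_simps)
    then show "r (x + z) \<le> r x + r z" by simp
  next
    have "r 0 \<le> 0" using le[of 0 0] sublinear_0[OF p] by (simp add: k_def)
    moreover have "0 \<le> r 0" using lower[of _ 0] sublinear_0[OF p] by (intro ge) simp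
    ultimately show "r 0 = 0" by simp
  next
    fix c :: real and x assume c: "c > 0"
    have "r (c *\<^sub>R x) / c \<le> k x t" if "t \<ge> 0" for t
    proof -
      have "r (c *\<^sub>R x) \<le> k (c *\<^sub>R x) (c * t)" using le that c by simp
      also have "\<dots> = c * k x t"
        using sublinear_scale[OF p, of c "x + t *\<^sub>R y"] c by (simp add: k_def algebra_simps)
      finally show ?thesis using c by (simp add: field_simps)
    qed
    then have "r (c *\<^sub>R x) / c \<le> r x" by (rule ge)
    then show "r (c *\<^sub>R x) \<le> c * r x" using c by (simp add: field_simps)
  qed
  moreover have "r x \<le> p x" for x using le[of 0 x] by (simp add: k_def)
  moreover have "r (- y) \<le> - p y"
    using le[of 1 "- y"] sublinear_0[OF p] by (simp add: k_def)
  ultimately show ?thesis by (rule that)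
qed

text \<open>Minimality makes \<open>sublinear_lower_at\<close> return the function itself, which is therefore
  odd; an odd sublinear function is linear.\<close>

lemma minimal_sublinear_imp_linear:
  assumes q: "sublinear q" and min: "\<And>r. sublinear r \<Longrightarrow> (\<And>x. r x \<le> q x) \<Longrightarrow> r = q"
  shows "linear q"
proof -
  have neg: "q (- y) = - q y" for y
  proof -
    obtain r where r: "sublinear r" "\<And>x. r x \<le> q x" "r (- y) \<le> - q y"
      using sublinear_lower_at[OF q, of y] by blast
    have "r = q" using r(1,2) by (rule min)
    then show ?thesis using r(3) sublinear_neg[OF q, of y] by simp
  qed
  have "q (x + y) = q x + q y" for x y
    using sublinear_add[OF q, of x y] sublinear_add[OF q, of "x + y" "- y"] neg[of y] by simp
  moreover have "q (c *\<^sub>R x) = c *\<^sub>R q x" for c x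
  proof (cases "c \<ge> 0")
    case False
    then show ?thesis using sublinear_scale[OF q, of "- c" x] neg[of "c *\<^sub>R x"] by simp
  qed (simp add: sublinear_scale[OF q])
  ultimately show ?thesis by (rule linearI)
qed

text \<open>Comparability of the members is what makes the infimum subadditive: any two bounds, one for \<open>x\<close>
  and one for \<open>y\<close>, are improved by a single member of the chain.\<close>

lemma sublinear_INF_chain:
  assumes ne: "C \<noteq> {}" and sub: "\<And>q. q \<in> C \<Longrightarrow> sublinear q"
    and le: "\<And>q. q \<in> C \<Longrightarrow> \<forall>x. q x \<le> p x"
    and chain: "\<And>q r. q \<in> C \<Longrightarrow> r \<in> C \<Longrightarrow> (\<forall>x. q x \<le> r x) \<or> (\<forall>x. r x \<le> q x)"
  defines "m \<equiv> \<lambda>x. INF q\<in>C. q x"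
  shows "sublinear m" and "\<And>q x. q \<in> C \<Longrightarrow> m x \<le> q x"
proof -
  have bdd: "bdd_below ((\<lambda>q. q x) ` C)" for x
  proof (rule bdd_belowI2[of _ "- p (- x)"])
    fix q assume "q \<in> C"
    then show "- p (- x) \<le> q x"
      using sublinear_neg[OF sub, of q x] le[of q] by (smt (verit))
  qed
  show lower: "m x \<le> q x" if "q \<in> C" for q x
    unfolding m_def by (rule cINF_lower[OF bdd that])
  have greatest: "a \<le> m x" if "\<And>q. q \<in> C \<Longrightarrow> a \<le> q x" for a x
    unfolding m_def by (rule cINF_greatest[OF ne that])
  obtain q0 where q0: "q0 \<in> C" using ne by blast
  show "sublinear m"
  proof (rule sublinearI)
    fix x y
    have "m (x + y) - q x \<le> r y" if qr: "q \<in> C" "r \<in> C" for q r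
    proof -
      from chain[OF qr] obtain s where s: "s \<in> C" "s x \<le> q x" "s y \<le> r y"
        using qr by blast
      then show ?thesis
        using lower[OF s(1), of "x + y"] sublinear_add[OF sub[OF s(1)], of x y] by simp
    qed
    then have "m (x + y) - q x \<le> m y" if "q \<in> C" for q
      using that by (intro greatest) auto
    then have "m (x + y) - m y \<le> m x"
      by (intro greatest) (simp add: algebra_simps)
    then show "m (x + y) \<le> m x + m y" by simp
  next
    have "m 0 \<le> 0" using lower[OF q0, of 0] sublinear_0[OF sub[OF q0]] by simp
    moreover have "0 \<le> m 0" by (rule greatest) (simp add: sublinear_0 sub)
    ultimately show "m 0 = 0" by simp
  next
    fix c :: real and x assume c: "c > 0"
    have "m (c *\<^sub>R x) / c \<le> m x"
    proof (rule greatest)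
      fix q assume q: "q \<in> C"
      show "m (c *\<^sub>R x) / c \<le> q x"
        using lower[OF q, of "c *\<^sub>R x"] sublinear_scale[OF sub[OF q], of c x] c
        by (simp add: field_simps)
    qed
    then show "m (c *\<^sub>R x) \<le> c * m x" using c by (simp add: field_simps)
  qed
qed

lemma ex_linear_le_sublinear:
  assumes p: "sublinear p"
  shows "\<exists>f. linear f \<and> (\<forall>x. f x \<le> p x)"
proof -
  let ?A = "{q. sublinear q \<and> (\<forall>x. q x \<le> p x)}"
  let ?P = "\<lambda>q r. \<forall>x. r x \<le> (q x :: real)"
  have "\<exists>q\<in>?A. \<forall>r\<in>?A. ?P q r \<longrightarrow> r = q"
  proof (rule predicate_Zorn)
    show "partial_order_on ?A (relation_of ?P ?A)"
      by (rule partial_order_on_relation_ofI) (auto simp: fun_eq_iff intro: order_trans antisym)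
    fix C assume C: "C \<in> Chains (relation_of ?P ?A)"
    then have CA: "C \<subseteq> ?A" and chain: "\<And>q r. q \<in> C \<Longrightarrow> r \<in> C \<Longrightarrow> ?P r q \<or> ?P q r"
      unfolding Chains_def relation_of_def by auto
    show "\<exists>u\<in>?A. \<forall>q\<in>C. ?P q u"
    proof (cases "C = {}")
      case True
      then show ?thesis using p by auto
    next
      case False
      have C': "\<And>q. q \<in> C \<Longrightarrow> sublinear q" "\<And>q. q \<in> C \<Longrightarrow> \<forall>x. q x \<le> p x"
        using CA by auto
      let ?m = "\<lambda>x. INF q\<in>C. q x"
      have inf: "sublinear ?m"
        by (rule sublinear_INF_chain(1)[of C p]) (use False C' chain in blast)+
      have inf_le: "?m x \<le> q x" if "q \<in> C" for q x
        by (rule sublinear_INF_chain(2)[of C p]) (use False C' chain that in blast)+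
      obtain q where q: "q \<in> C" using False by blast
      have "?m x \<le> p x" for x
        using inf_le[OF q, of x] C'(2)[OF q] order_trans by blast
      then have "?m \<in> ?A" using inf by simp
      then show ?thesis using inf_le by (intro bexI[of _ ?m]) auto
    qed
  qed
  then obtain q where q: "sublinear q" "\<And>x. q x \<le> p x"
    and min: "\<And>r. sublinear r \<Longrightarrow> (\<And>x. r x \<le> p x) \<Longrightarrow> (\<And>x. r x \<le> q x) \<Longrightarrow> r = q"
    by auto
  have "linear q"
    using q(1)
  proof (rule minimal_sublinear_imp_linear)
    fix r assume r: "sublinear r" "\<And>x. r x \<le> q x"
    show "r = q"
      using r(1) order_trans[OF r(2) q(2)] r(2) by (rule min)
  qed
  then show ?thesis using q(2) by blast
qed

text \<open>Lowering \<open>p\<close> at \<open>- y\<close> beforehand forces the linear minorant to touch \<open>p\<close> at \<open>y\<close>.\<close>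

theorem hahn_banach_sublinear:
  assumes p: "sublinear p"
  obtains f where "linear f" "\<And>x. f x \<le> p x" "f y = p y"
proof -
  obtain r where r: "sublinear r" "\<And>x. r x \<le> p x" "r (- y) \<le> - p y"
    using sublinear_lower_at[OF p, of y] by blast
  obtain f where f: "linear f" "\<And>x. f x \<le> r x"
    using ex_linear_le_sublinear[OF r(1)] by blast
  have le: "f x \<le> p x" for x using f(2)[of x] r(2)[of x] by linarith
  moreover have "p y \<le> f y"
    using f(2)[of "- y"] r(3) linear_neg[OF f(1), of y] by simp
  ultimately show ?thesis using that[OF f(1) le] le[of y] by simp
qed

lemma sublinear_infdist:
  fixes G :: "'a::real_normed_vector set"
  assumes G: "subspace G"
  shows "sublinear (\<lambda>x. infdist x G)"
proof (rule sublinearI)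
  have ne: "G \<noteq> {}" using subspace_0[OF G] by blast
  have le: "infdist x G \<le> norm (x - a)" if "a \<in> G" for x a
    using infdist_le[OF that, of x] by (simp add: dist_norm)
  have ge: "b \<le> infdist x G" if "\<And>a. a \<in> G \<Longrightarrow> b \<le> norm (x - a)" for x b
    unfolding infdist_notempty[OF ne]
    by (rule cINF_greatest[OF ne]) (use that in \<open>simp add: dist_norm\<close>)
  show "infdist 0 G = 0" using subspace_0[OF G] by simp
  fix x y
  have "infdist (x + y) G - norm (x - a) \<le> norm (y - b)" if "a \<in> G" "b \<in> G" for a b
    using le[OF subspace_add[OF G that], of "x + y"] norm_triangle_ineq[of "x - a" "y - b"]
    by (simp add: algebra_simps)
  then have "infdist (x + y) G - norm (x - a) \<le> infdist y G" if "a \<in> G" for a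
    using that by (intro ge) auto
  then have "infdist (x + y) G - infdist y G \<le> infdist x G"
    by (intro ge) (simp add: algebra_simps)
  then show "infdist (x + y) G \<le> infdist x G + infdist y G" by simp
  fix c :: real assume c: "c > 0"
  have "infdist (c *\<^sub>R x) G / c \<le> infdist x G"
  proof (rule ge)
    fix a assume "a \<in> G"
    then have "infdist (c *\<^sub>R x) G \<le> norm (c *\<^sub>R (x - a))"
      using le[OF subspace_scale[OF G], of a "c *\<^sub>R x" c] by (simp add: scaleR_diff_right)
    then show "infdist (c *\<^sub>R x) G / c \<le> norm (x - a)"
      using c norm_scaleR[of c "x - a"] by (simp add: pos_divide_le_eq mult.commute)
  qed
  then show "infdist (c *\<^sub>R x) G \<le> c * infdist x G" using c by (simp add: field_simps)
qed

text \<open>The distance to \<open>G\<close> is a seminorm that vanishes on \<open>G\<close> and is dominated by the norm, so a linear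
  minorant of it vanishes on \<open>G\<close> and is bounded.\<close>

theorem separate_point_from_closed_subspace:
  fixes G :: "'a::real_normed_vector set"
  assumes G: "subspace G" and cl: "closed G" and x: "x \<notin> G"
  obtains f :: "'a \<Rightarrow> real" where "bounded_linear f" "\<And>y. y \<in> G \<Longrightarrow> f y = 0" "f x \<noteq> 0"
proof -
  obtain f where f: "linear f" "\<And>y. f y \<le> infdist y G" "f x = infdist x G"
    using hahn_banach_sublinear[OF sublinear_infdist[OF G], of x] by blast
  have dist: "infdist y G \<le> norm y" for y
    using infdist_le[OF subspace_0[OF G], of y] by simp
  have "\<bar>f y\<bar> \<le> norm y" for y
    using f(2)[of y] f(2)[of "- y"] dist[of y] dist[of "- y"] linear_neg[OF f(1), of y] by simp
  then have "bounded_linear f"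
    using f(1) by (intro bounded_linear_intro[of f 1]) (auto simp: linear_add linear_scale)
  moreover have "f y = 0" if "y \<in> G" for y
    using f(2)[of y] f(2)[of "- y"] that subspace_neg[OF G that] linear_neg[OF f(1), of y] by simp
  moreover have "f x \<noteq> 0"
    using f(3) x in_closed_iff_infdist_zero[OF cl, of x] subspace_0[OF G] by auto
  ultimately show ?thesis by (rule that)
qed

section \<open>Finite-dimensional subspaces and operators\<close>

text \<open>If \<open>b \<notin> span B\<close>, a bounded functional that vanishes on \<open>span B\<close> and is \<open>1\<close> at \<open>b\<close> reads off the
  coefficient of \<open>b\<close>, so \<open>span (insert b B)\<close> is the preimage of \<open>span B\<close> under a continuous map.\<close>

lemma closed_span_finite:
  fixes B :: "'a::real_normed_vector set"
  assumes "finite B"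
  shows "closed (span B)"
  using assms
proof (induction B rule: finite_induct)
  case (insert b B)
  show ?case
  proof (cases "b \<in> span B")
    case True
    then show ?thesis using insert.IH by (simp add: span_redundant)
  next
    case False
    obtain f :: "'a \<Rightarrow> real" where f: "bounded_linear f" "\<And>y. y \<in> span B \<Longrightarrow> f y = 0" "f b \<noteq> 0"
      using separate_point_from_closed_subspace[OF subspace_span insert.IH False] by blast
    interpret f: bounded_linear f by (rule f(1))
    have "span (insert b B) = (\<lambda>x. x - (f x / f b) *\<^sub>R b) -` span B"
    proof (intro set_eqI iffI)
      fix x assume "x \<in> span (insert b B)"
      then obtain k where k: "x - k *\<^sub>R b \<in> span B" by (auto simp: span_insert)
      then have "f x = k * f b" using f(2)[OF k] by (simp add: f.diff f.scaleR)
      then show "x \<in> (\<lambda>x. x - (f x / f b) *\<^sub>R b) -` span B" using k f(3) by simp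
    qed (auto simp: span_insert)
    moreover have "continuous_on UNIV (\<lambda>x. x - (f x / f b) *\<^sub>R b)"
      using f(3) by (intro continuous_intros f.continuous_on) auto
    ultimately show ?thesis
      using insert.IH by (simp add: closed_vimage continuous_on_eq_continuous_at)
  qed
qed simp

lemma closed_subspace_of_finite_span:
  fixes V :: "'a::real_normed_vector set"
  assumes V: "subspace V" and sub: "V \<subseteq> span B" and B: "finite B"
  shows "closed V"
proof -
  obtain C where C: "C \<subseteq> V" "independent C" "V \<subseteq> span C"
    using maximal_independent_subset[of V] by blast
  have "finite C" using independent_span_bound[OF B C(2)] C(1) sub by blast
  moreover have "span C = V" using C(1,3) V by (simp add: span_minimal antisym)
  ultimately show ?thesis using closed_span_finite[of C] by simp
qed

lemma finite_rank_two_functionals: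
  assumes "\<And>y. blinfun_apply T y = f y *\<^sub>R v + g y *\<^sub>R w"
  shows "finite_rank T"
  unfolding finite_rank_def
proof (intro exI conjI)
  show "range (blinfun_apply T) \<subseteq> span {v, w}"
    unfolding assms by (intro image_subsetI span_add span_scale span_base) auto
qed simp

lemma compact_operator_two_functionals:
  fixes f g :: "'a::real_normed_vector \<Rightarrow> real"
  assumes f: "bounded_linear f" and g: "bounded_linear g"
    and T: "\<And>y. blinfun_apply T y = f y *\<^sub>R v + g y *\<^sub>R w"
  shows "compact_operator T"
  unfolding compact_operator_def
proof (intro allI impI)
  fix B :: "'a set" assume B: "bounded B"
  define K where "K = (\<lambda>(a, b). a *\<^sub>R v + b *\<^sub>R w) ` (closure (f ` B) \<times> closure (g ` B))"
  have "compact (closure (f ` B))" "compact (closure (g ` B))"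
    using bounded_linear_image[OF B f] bounded_linear_image[OF B g] by simp_all
  then have "compact K"
    unfolding K_def
    by (intro compact_continuous_image compact_Times)
      (auto simp: case_prod_beta intro!: continuous_intros)
  have "blinfun_apply T ` B \<subseteq> K"
  proof
    fix z assume "z \<in> blinfun_apply T ` B"
    then obtain y where y: "y \<in> B" "z = f y *\<^sub>R v + g y *\<^sub>R w" using T by auto
    then have "(f y, g y) \<in> closure (f ` B) \<times> closure (g ` B)"
      using closure_subset by fastforce
    then show "z \<in> K" unfolding K_def y(2) by force
  qed
  then have "closure (blinfun_apply T ` B) \<subseteq> K"
    using \<open>compact K\<close> by (simp add: closure_minimal compact_imp_closed)
  then show "compact (closure (blinfun_apply T ` B))"
    using compact_Int_closed[OF \<open>compact K\<close>, of "closure (blinfun_apply T ` B)"]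
    by (simp add: Int_absorb1)
qed

section \<open>Rank-one operators over the complex numbers\<close>

locale closed_partial_complex_structure =
  fixes D :: "'a::banach set" and S :: "'a \<Rightarrow> 'a"
  assumes complex_structure: "partial_complex_structure D S"
    and closed_operator: "closed_operator D S"
begin

abbreviation "A \<equiv> commuting_algebra D S"

lemma dense: "closure D = UNIV"
  and S_in: "x \<in> D \<Longrightarrow> S x \<in> D"
  and S_S: "x \<in> D \<Longrightarrow> S (S x) = - x"
  and subspace_D: "subspace D"
  and S_add: "x \<in> D \<Longrightarrow> y \<in> D \<Longrightarrow> S (x + y) = S x + S y"
  and S_scale: "x \<in> D \<Longrightarrow> S (c *\<^sub>R x) = c *\<^sub>R S x"
  using complex_structure by (auto simp: partial_complex_structure_iff linear_operator_on_def)

lemma D_add: "x \<in> D \<Longrightarrow> y \<in> D \<Longrightarrow> x + y \<in> D"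
  and D_scale: "x \<in> D \<Longrightarrow> c *\<^sub>R x \<in> D"
  and D_0: "0 \<in> D"
  using subspace_D by (auto simp: subspace_add subspace_scale subspace_0)

lemma S_0: "S 0 = 0"
  using S_scale[OF D_0, of 0] by simp

lemma complex_combination_in:
  "x \<in> D \<Longrightarrow> a *\<^sub>R x + b *\<^sub>R S x \<in> D"
  by (simp add: D_add D_scale S_in)

lemma S_complex_combination:
  "x \<in> D \<Longrightarrow> S (a *\<^sub>R x + b *\<^sub>R S x) = a *\<^sub>R S x - b *\<^sub>R x"
  by (simp add: S_add S_scale D_scale S_in S_S)

text \<open>Multiply by the conjugate \<open>a - b S\<close>.\<close>

lemma complex_combination_eq_0:
  assumes x: "x \<in> D" "x \<noteq> 0" and eq: "a *\<^sub>R x + b *\<^sub>R S x = 0"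
  shows "a = 0 \<and> b = 0"
proof -
  have eq': "a *\<^sub>R S x - b *\<^sub>R x = 0"
    using S_complex_combination[OF x(1), of a b] eq S_0 by simp
  have "(a * a + b * b) *\<^sub>R x
      = a *\<^sub>R (a *\<^sub>R x + b *\<^sub>R S x) - b *\<^sub>R (a *\<^sub>R S x - b *\<^sub>R x)"
    by (simp add: algebra_simps)
  then have "(a * a + b * b) *\<^sub>R x = 0" using eq eq' by simp
  then show ?thesis using x(2) by (simp add: sum_squares_eq_zero_iff)
qed

lemma closed_graph: "closed {(x, S x) |x. x \<in> D}"
  using closed_operator by (simp add: closed_operator_def)

lemma subspace_graph: "subspace {(x, S x) |x. x \<in> D}"
  unfolding subspace_def
proof (intro conjI ballI allI)
  show "0 \<in> {(x, S x) |x. x \<in> D}" using D_0 S_0 by (force simp: zero_prod_def)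
next
  fix z w assume "z \<in> {(x, S x) |x. x \<in> D}" "w \<in> {(x, S x) |x. x \<in> D}"
  then obtain x y where "z = (x, S x)" "w = (y, S y)" "x \<in> D" "y \<in> D" by blast
  then show "z + w \<in> {(x, S x) |x. x \<in> D}" using D_add S_add by force
next
  fix c :: real and z assume "z \<in> {(x, S x) |x. x \<in> D}"
  then obtain x where "z = (x, S x)" "x \<in> D" by blast
  then show "c *\<^sub>R z \<in> {(x, S x) |x. x \<in> D}" using D_scale S_scale by force
qed

text \<open>The components of a bounded functional on the product space that annihilates the graph of \<open>S\<close> but
  not \<open>(0, x)\<close> are, up to a complex factor, the real and imaginary parts of a functional that is
  complex linear on \<open>D\<close>.\<close>

lemma complex_functional:
  assumes x: "x \<noteq> 0"
  obtains f g :: "'a \<Rightarrow> real"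
  where "bounded_linear f" "bounded_linear g" "f x = 1" "g x = 0"
    "\<And>y. y \<in> D \<Longrightarrow> f (S y) = - g y" "\<And>y. y \<in> D \<Longrightarrow> g (S y) = f y"
proof -
  have notin: "(0, x) \<notin> {(x, S x) |x. x \<in> D}" using x S_0 by auto
  obtain F :: "'a \<times> 'a \<Rightarrow> real" where F: "bounded_linear F"
    "\<And>z. z \<in> {(x, S x) |x. x \<in> D} \<Longrightarrow> F z = 0" "F (0, x) \<noteq> 0"
    using separate_point_from_closed_subspace[OF subspace_graph closed_graph notin] by blast
  interpret F: bounded_linear F by (rule F(1))
  define f g where "f y = F (0, y)" and "g y = F (y, 0)" for y
  have lin: "bounded_linear f" "bounded_linear g"
    unfolding f_def g_def
    by (intro bounded_linear_compose[OF F(1)] bounded_linear_Pair bounded_linear_zero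
        bounded_linear_ident)+
  have fS: "f (S y) = - g y" if "y \<in> D" for y
    using F(2)[of "(y, S y)"] F.add[of "(0, S y)" "(y, 0)"] that by (simp add: f_def g_def)
  have gS: "g (S y) = f y" if "y \<in> D" for y
    using fS[OF S_in[OF that]] S_S[OF that] linear_neg[OF bounded_linear.linear[OF lin(1)]]
    by simp
  define n where "n = f x * f x + g x * g x"
  have n: "n \<noteq> 0" using F(3) by (simp add: n_def f_def sum_squares_eq_zero_iff)
  \<comment> \<open>Divide \<open>f + i g\<close> by the nonzero complex number \<open>f x + i g x\<close>.\<close>
  define f' g' where "f' y = (f x * f y + g x * g y) / n" and "g' y = (f x * g y - g x * f y) / n"
    for y
  show ?thesis
  proof
    show "bounded_linear f'" "bounded_linear g'"
      unfolding f'_def g'_def divide_inverse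
      by (intro bounded_linear_add bounded_linear_sub bounded_linear_const_mult
          bounded_linear_mult_const lin)+
    show "f' x = 1" "g' x = 0" using n by (simp_all add: f'_def g'_def n_def)
  qed (simp_all add: f'_def g'_def fS gS field_simps diff_divide_distrib add_divide_distrib)
qed

lemma complex_rank_one:
  assumes x: "x \<noteq> 0"
  obtains f g :: "'a \<Rightarrow> real"
  where "bounded_linear f" "bounded_linear g" "f x = 1" "g x = 0"
    "\<And>v. v \<in> D \<Longrightarrow> \<exists>T\<in>A. \<forall>y. blinfun_apply T y = f y *\<^sub>R v + g y *\<^sub>R S v"
proof -
  obtain f g :: "'a \<Rightarrow> real" where fg: "bounded_linear f" "bounded_linear g" "f x = 1" "g x = 0"
    and fS: "\<And>y. y \<in> D \<Longrightarrow> f (S y) = - g y" and gS: "\<And>y. y \<in> D \<Longrightarrow> g (S y) = f y"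
    using complex_functional[OF x] by metis
  have "\<exists>T\<in>A. \<forall>y. blinfun_apply T y = f y *\<^sub>R v + g y *\<^sub>R S v" if v: "v \<in> D" for v
  proof -
    define T where "T = Blinfun (\<lambda>y. f y *\<^sub>R v + g y *\<^sub>R S v)"
    have "bounded_linear (\<lambda>y. f y *\<^sub>R v + g y *\<^sub>R S v)"
      by (intro bounded_linear_add bounded_linear_scaleR_const fg)
    then have T: "blinfun_apply T y = f y *\<^sub>R v + g y *\<^sub>R S v" for y
      unfolding T_def by (simp add: bounded_linear_Blinfun_apply)
    have "T \<in> A"
      using v by (simp add: commuting_algebra_def T fS gS complex_combination_in
          S_complex_combination)
    then show ?thesis using T by blast
  qed
  then show ?thesis using that fg by blast
qed

section \<open>Commuting operators form a Lomonosov algebra\<close>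

lemma subalgebra_commuting: "subalgebra A"
  unfolding subalgebra_def subspace_def commuting_algebra_def
  by (auto simp: blinfun.add_left blinfun.scaleR_left D_0 S_0 D_add D_scale S_add S_scale S_in)

lemma transitive_commuting: "transitive A"
  unfolding transitive_def
proof (intro allI impI)
  fix M assume M: "subspace M \<and> closed M \<and> (\<forall>T\<in>A. blinfun_apply T ` M \<subseteq> M)"
  show "M = {0} \<or> M = UNIV"
  proof (cases "M \<subseteq> {0}")
    case True
    then show ?thesis using M subspace_0 by blast
  next
    case False
    then obtain x where x: "x \<in> M" "x \<noteq> 0" by blast
    obtain f g where fg: "f x = 1" "g x = 0"
      "\<And>v. v \<in> D \<Longrightarrow> \<exists>T\<in>A. \<forall>y. blinfun_apply T y = f y *\<^sub>R v + g y *\<^sub>R S v"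
      using complex_rank_one[OF x(2)] by metis
    have "v \<in> M" if v: "v \<in> D" for v
    proof -
      obtain T where T: "T \<in> A" "\<And>y. blinfun_apply T y = f y *\<^sub>R v + g y *\<^sub>R S v"
        using fg(3)[OF v] by blast
      have "blinfun_apply T x = v" by (simp add: T(2) fg(1,2))
      then show ?thesis using M T(1) x(1) by blast
    qed
    then have "closure D \<subseteq> M" using M by (intro closure_minimal) auto
    then show ?thesis using dense by auto
  qed
qed

text \<open>Membership of \<open>T\<close> says that \<open>(T x, T (S x))\<close> lies in the closed graph of \<open>S\<close> for each \<open>x \<in> D\<close>,
  and evaluation at a point is continuous for the strong operator topology.\<close>

lemma closedin_commuting: "closedin strong_operator_topology A"
proof -
  let ?G = "{(x, S x) |x. x \<in> D}"
  let ?C = "\<lambda>x. {T \<in> topspace strong_operator_topology.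
      (blinfun_apply T x, blinfun_apply T (S x)) \<in> ?G}"
  have "closedin strong_operator_topology (?C x)" for x
  proof (rule closedin_continuous_map_preimage)
    have "continuous_map strong_operator_topology (prod_topology euclidean euclidean)
        (\<lambda>T. (blinfun_apply T x, blinfun_apply T (S x)))"
      by (intro continuous_map_pairedI strong_operator_topology_continuous_evaluation)
    then show "continuous_map strong_operator_topology euclidean
        (\<lambda>T. (blinfun_apply T x, blinfun_apply T (S x)))"
      by simp
    show "closedin euclidean ?G" using closed_graph by simp
  qed
  then have "closedin strong_operator_topology (\<Inter>x\<in>D. ?C x)"
    using D_0 by (intro closedin_INT) auto
  moreover have "(\<Inter>x\<in>D. ?C x) = A"
    using D_0 by (auto simp: commuting_algebra_def strong_operator_topology_topspace)
  ultimately show ?thesis by simp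
qed

lemma ex_nonzero_finite_rank_compact:
  assumes "(UNIV :: 'a set) \<noteq> {0}"
  shows "\<exists>T\<in>A. T \<noteq> 0 \<and> finite_rank T \<and> compact_operator T"
proof -
  have "D \<noteq> {0}" using assms dense by auto
  then obtain u where u: "u \<in> D" "u \<noteq> 0" using D_0 by blast
  obtain f g where fg: "bounded_linear f" "bounded_linear g" "f u = 1" "g u = 0"
    "\<And>v. v \<in> D \<Longrightarrow> \<exists>T\<in>A. \<forall>y. blinfun_apply T y = f y *\<^sub>R v + g y *\<^sub>R S v"
    using complex_rank_one[OF u(2)] by metis
  obtain T where T: "T \<in> A" "\<And>y. blinfun_apply T y = f y *\<^sub>R u + g y *\<^sub>R S u"
    using fg(5)[OF u(1)] by blast
  have "blinfun_apply T u = u" by (simp add: T(2) fg)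
  then have "T \<noteq> 0" using u(2) by auto
  then show ?thesis
    using T finite_rank_two_functionals[OF T(2)]
      compact_operator_two_functionals[OF fg(1,2) T(2)] by blast
qed

section \<open>The commutant of the finite rank part\<close>

text \<open>The image of \<open>D\<close> is dense in the range and, being finite-dimensional, closed; so it is the whole
  range.\<close>

lemma finite_rank_range_subset:
  assumes T: "T \<in> A" and fin: "finite_rank T"
  shows "range (blinfun_apply T) \<subseteq> D"
proof -
  obtain B where B: "finite B" "range (blinfun_apply T) \<subseteq> span B"
    using fin unfolding finite_rank_def by blast
  have TD: "blinfun_apply T ` D \<subseteq> D" using T by (auto simp: commuting_algebra_def)
  have "subspace (blinfun_apply T ` D)"
    by (intro linear_subspace_image subspace_D bounded_linear.linear blinfun.bounded_linear_right)
  then have cl: "closed (blinfun_apply T ` D)"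
    using B by (intro closed_subspace_of_finite_span[of _ B]) auto
  have "blinfun_apply T ` closure D \<subseteq> closure (blinfun_apply T ` D)"
    by (rule closure_bounded_linear_image_subset[OF blinfun.bounded_linear_right])
  then show ?thesis using TD cl dense by auto
qed

lemma finite_rank_space_eq:
  assumes "(UNIV :: 'a set) \<noteq> {0}"
  shows "finite_rank_space A = D"
proof
  show "finite_rank_space A \<subseteq> D"
    unfolding finite_rank_space_def finite_rank_part_def
    by (rule span_minimal[OF _ subspace_D]) (use finite_rank_range_subset in blast)
  obtain x :: 'a where x: "x \<noteq> 0" using assms by auto
  obtain f g where fg: "f x = 1" "g x = 0"
    "\<And>v. v \<in> D \<Longrightarrow> \<exists>T\<in>A. \<forall>y. blinfun_apply T y = f y *\<^sub>R v + g y *\<^sub>R S v"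
    using complex_rank_one[OF x] by metis
  show "D \<subseteq> finite_rank_space A"
  proof
    fix v assume "v \<in> D"
    then obtain T where T: "T \<in> A" "\<And>y. blinfun_apply T y = f y *\<^sub>R v + g y *\<^sub>R S v"
      using fg(3) by blast
    have "T \<in> finite_rank_part A" "blinfun_apply T x = v"
      using T finite_rank_two_functionals[OF T(2)] by (simp_all add: finite_rank_part_def fg)
    then show "v \<in> finite_rank_space A"
      unfolding finite_rank_space_def by (blast intro: span_base)
  qed
qed

definition complex_scalar :: "complex \<Rightarrow> 'a \<Rightarrow> 'a" where
  "complex_scalar z = restrict (\<lambda>x. Re z *\<^sub>R x + Im z *\<^sub>R S x) D"

lemma complex_scalar_apply: "x \<in> D \<Longrightarrow> complex_scalar z x = Re z *\<^sub>R x + Im z *\<^sub>R S x"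
  by (simp add: complex_scalar_def)

lemma inj_complex_scalar:
  assumes "(UNIV :: 'a set) \<noteq> {0}"
  shows "inj complex_scalar"
proof (rule injI)
  fix z w assume eq: "complex_scalar z = complex_scalar w"
  have "D \<noteq> {0}" using assms dense by auto
  then obtain u where u: "u \<in> D" "u \<noteq> 0" using D_0 by blast
  have "(Re z - Re w) *\<^sub>R u + (Im z - Im w) *\<^sub>R S u = 0"
    using fun_cong[OF eq, of u] u(1) by (simp add: complex_scalar_apply algebra_simps)
  then show "z = w" 
    using complex_combination_eq_0[OF u, of "Re z - Re w" "Im z - Im w"]
    by (simp add: complex_eq_iff)
qed

lemma complex_scalar_in_commutant:
  assumes "(UNIV :: 'a set) \<noteq> {0}"
  shows "complex_scalar z \<in> finite_rank_commutant A"
  unfolding finite_rank_commutant_def finite_rank_space_eq[OF assms]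
proof (intro CollectI conjI ballI)
  show "complex_scalar z \<in> D \<rightarrow>\<^sub>E D"
    by (auto simp: complex_scalar_def complex_combination_in)
  show "linear_operator_on D (complex_scalar z)"
    by (auto simp: linear_operator_on_def subspace_D complex_scalar_apply D_add D_scale S_add
        S_scale algebra_simps)
  fix T x assume "T \<in> finite_rank_part A" and x: "x \<in> D"
  then have "blinfun_apply T x \<in> D" "blinfun_apply T (S x) = S (blinfun_apply T x)"
    by (auto simp: finite_rank_part_def commuting_algebra_def)
  then show "complex_scalar z (blinfun_apply T x) = blinfun_apply T (complex_scalar z x)"
    using x by (simp add: complex_scalar_apply blinfun.add_right blinfun.scaleR_right)
qed

text \<open>With \<open>T\<^sub>v u = v\<close> for a fixed \<open>u\<close>, an element \<open>R\<close> of the commutant satisfies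
  \<open>R v = T\<^sub>v (R u)\<close>, and the right-hand side is a complex multiple of \<open>v\<close> by a factor that depends only
  on \<open>R u\<close>.\<close>

lemma commutant_is_complex_scalar:
  assumes nz: "(UNIV :: 'a set) \<noteq> {0}" and R: "R \<in> finite_rank_commutant A"
  shows "R \<in> range complex_scalar"
proof -
  have R_ext: "R \<in> D \<rightarrow>\<^sub>E D"
    and R_comm: "\<And>T x. T \<in> finite_rank_part A \<Longrightarrow> x \<in> D \<Longrightarrow>
      R (blinfun_apply T x) = blinfun_apply T (R x)"
    using R unfolding finite_rank_commutant_def finite_rank_space_eq[OF nz] by blast+
  have "D \<noteq> {0}" using nz dense by auto
  then obtain u where u: "u \<in> D" "u \<noteq> 0" using D_0 by blast
  obtain f g where fg: "f u = 1" "g u = 0"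
    "\<And>v. v \<in> D \<Longrightarrow> \<exists>T\<in>A. \<forall>y. blinfun_apply T y = f y *\<^sub>R v + g y *\<^sub>R S v"
    using complex_rank_one[OF u(2)] by metis
  have "R v = complex_scalar (Complex (f (R u)) (g (R u))) v" if v: "v \<in> D" for v
  proof -
    obtain T where T: "T \<in> A" "\<And>y. blinfun_apply T y = f y *\<^sub>R v + g y *\<^sub>R S v"
      using fg(3)[OF v] by blast
    have "T \<in> finite_rank_part A" "blinfun_apply T u = v"
      using T finite_rank_two_functionals[OF T(2)] by (simp_all add: finite_rank_part_def fg)
    then have "R v = blinfun_apply T (R u)" using R_comm[of T u] u(1) by simp
    then show ?thesis using v by (simp add: T(2) complex_scalar_apply)
  qed
  then have "R = complex_scalar (Complex (f (R u)) (g (R u)))"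
    using R_ext by (intro extensionalityI[of _ D]) (auto simp: complex_scalar_def PiE_def)
  then show ?thesis by (rule range_eqI)
qed

lemma complex_type_commuting:
  assumes nz: "(UNIV :: 'a set) \<noteq> {0}"
  shows "complex_type A"
  unfolding complex_type_def
proof (intro conjI exI)
  show "L_algebra A"
    using subalgebra_commuting transitive_commuting ex_nonzero_finite_rank_compact[OF nz]
    unfolding L_algebra_def by blast
  have "range complex_scalar = finite_rank_commutant A"
    using complex_scalar_in_commutant[OF nz] commutant_is_complex_scalar[OF nz] by blast
  then show "bij_betw complex_scalar UNIV (finite_rank_commutant A)"
    using inj_complex_scalar[OF nz] by (simp add: bij_betw_def)
  show "\<forall>x\<in>finite_rank_space A. \<forall>z w c.
      complex_scalar (z + w) x = complex_scalar z x + complex_scalar w x \<and>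
      complex_scalar (c *\<^sub>R z) x = c *\<^sub>R complex_scalar z x \<and>
      complex_scalar (z * w) x = complex_scalar z (complex_scalar w x)"
    unfolding finite_rank_space_eq[OF nz]
    by (simp add: complex_scalar_apply complex_combination_in S_complex_combination algebra_simps)
qed

lemma Lomonosov_algebra_commuting:
  assumes nz: "(UNIV :: 'a set) \<noteq> {0}"
  shows "Lomonosov_algebra A"
  unfolding Lomonosov_algebra_def
  using subalgebra_commuting transitive_commuting closedin_commuting
    ex_nonzero_finite_rank_compact[OF nz] by blast

end

theorem theorem3p2:
  fixes D :: "'a::banach set" and S :: "'a \<Rightarrow> 'a"
  assumes "\<nexists>B :: 'a set. finite B \<and> span B = UNIV"
    and "partial_complex_structure D S"
    and "closed_operator D S"
  shows "Lomonosov_algebra (commuting_algebra D S) \<and> complex_type (commuting_algebra D S)"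
proof -
  interpret closed_partial_complex_structure D S
    using assms(2,3) by unfold_locales
  have nz: "(UNIV :: 'a set) \<noteq> {0}"
    using assms(1) by (metis finite.emptyI span_empty)
  show ?thesis using Lomonosov_algebra_commuting[OF nz] complex_type_commuting[OF nz] by blast
qed

end
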